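(* Let $\mathcal{H}$ be a non-trivial complex Hilbert space, let $A\neq 0$ be a positive operator on $\mathcal{H}$, and let $T\in \mathcal{B}_{A^{1/2}}(\mathcal{H})$. Then $T$ is $A$-normaloid if and only if $\omega_A(T)=\omega_{\max}^A(T)$.
   Context: $\mathcal{B}(\mathcal{H})$ is the algebra of bounded linear operators on $\mathcal{H}$; inner product $\langle\cdot\mid\cdot\rangle$. $A\in\mathcal{B}(\mathcal{H})$ is positive if $\langle Ax\mid x\rangle\ge 0$ for all $x\in\mathcal{H}$. Put $\langle x\mid y\rangle_A:=\langle Ax\mid y\rangle$ and $\|x\|_A:=\langle x\mid x\rangle_A^{1/2}$ (a seminorm). $\mathcal{B}_{A^{1/2}}(\mathcal{H})$ is the set of $A$-bounded operators: those $T\in\mathcal{B}(\mathcal{H})$ for which there is $\lambda>0$ with $\|Tx\|_A\le\lambda\|x\|_A$ for all $x\in\mathcal{H}$. For such $T$, $\|T\|_A:=\sup\{\|Tx\|_A/\|x\|_A : x\in\overline{\mathcal{R}(A)},\ x\neq 0\}$, where $\mathcal{R}(A)$ is the range of $A$ (closure in the norm of $\mathcal{H}$). The $A$-spectral radius of $T\in\mathcal{B}_{A^{1/2}}(\mathcal{H})$ is $r_A(T):=\inf_{n\in\mathbb{N}^*}\|T^n\|_A^{1/n}$, with $\mathbb{N}^*$ the set of positive integers. The $A$-numerical radius is $\omega_A(T):=\sup\{|\langle Tx\mid x\rangle_A| : x\in\mathcal{H},\ \|x\|_A=1\}$. An operator $T\in\mathcal{B}_{A^{1/2}}(\mathcal{H})$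 is $A$-normaloid if $r_A(T)=\|T\|_A$. The $A$-maximal numerical range of $T$ is the set $W_{\max}^A(T)$ of all $\lambda\in\mathbb{C}$ for which there is a sequence $(x_n)_n\subset\mathcal{H}$ with $\|x_n\|_A=1$ for all $n$, $\lim_{n\to\infty}\langle Tx_n\mid x_n\rangle_A=\lambda$ and $\lim_{n\to\infty}\|Tx_n\|_A=\|T\|_A$. The $A$-maximal numerical radius is $\omega_{\max}^A(T):=\sup\{|\lambda| : \lambda\in W_{\max}^A(T)\}$. *)

theory Defs
  imports "HOL-Analysis.Analysis"
begin

section \<open>Complex Hilbert spaces\<close>

class complex_vector = real_vector +
  fixes scaleC :: "complex \<Rightarrow> 'a \<Rightarrow> 'a"  (infixr \<open>*\<^sub>C\<close> 75)
  assumes scaleC_add_right: "a *\<^sub>C (x + y) = a *\<^sub>C x + a *\<^sub>C y"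
    and scaleC_add_left: "(a + b) *\<^sub>C x = a *\<^sub>C x + b *\<^sub>C x"
    and scaleC_scaleC: "a *\<^sub>C b *\<^sub>C x = (a * b) *\<^sub>C x"
    and scaleC_one: "1 *\<^sub>C x = x"
    and scaleR_scaleC: "r *\<^sub>R x = complex_of_real r *\<^sub>C x"

text \<open>
  The inner product is linear in its first argument. Its real part is the inner product of
  the underlying real inner product space; together with conjugate symmetry this makes
  \<open>cinner x x\<close> the real number \<open>(norm x)\<^sup>2\<close>, so that positive definiteness and
  the norm and topology are those of \<^class>\<open>real_inner\<close>.
\<close>

class complex_inner = complex_vector + real_inner +
  fixes cinner :: "'a \<Rightarrow> 'a \<Rightarrow> complex"
  assumes cinner_commute: "cinner x y = cnj (cinner y x)"
    and cinner_add_left: "cinner (x + y) z = cinner x z + cinner y z"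
    and cinner_scaleC_left: "cinner (a *\<^sub>C x) y = a * cinner x y"
    and inner_eq_Re_cinner: "inner x y = Re (cinner x y)"

class chilbert_space = complex_inner + complete_space

lemma cinner_self:
  fixes x :: "'a::complex_inner"
  shows "cinner x x = complex_of_real ((norm x)\<^sup>2)"
proof -
  have "Im (cinner x x) = 0"
    using arg_cong[OF cinner_commute[of x x], of Im] by simp
  moreover have "Re (cinner x x) = (norm x)\<^sup>2"
    by (simp add: inner_eq_Re_cinner[symmetric] power2_norm_eq_inner)
  ultimately show ?thesis
    by (simp add: complex_eq_iff)
qed

instantiation complex :: chilbert_space
begin

definition scaleC_complex :: "complex \<Rightarrow> complex \<Rightarrow> complex"
  where "scaleC_complex a x = a * x"

definition cinner_complex :: "complex \<Rightarrow> complex \<Rightarrow> complex"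
  where "cinner_complex x y = x * cnj y"

instance
  by standard
    (auto simp: scaleC_complex_def cinner_complex_def inner_complex_def scaleR_conv_of_real
      algebra_simps)

end

section \<open>Operators on a semi-Hilbertian space\<close>

definition bounded_clinear :: "('a::complex_inner \<Rightarrow> 'a) \<Rightarrow> bool"
  where "bounded_clinear T \<longleftrightarrow> bounded_linear T \<and> (\<forall>c x. T (c *\<^sub>C x) = c *\<^sub>C T x)"

definition positive_operator :: "('a::complex_inner \<Rightarrow> 'a) \<Rightarrow> bool"
  where "positive_operator A \<longleftrightarrow> bounded_clinear A \<and> (\<forall>x. cinner (A x) x \<in> \<real>\<^sub>\<ge>\<^sub>0)"

definition A_inner :: "('a::complex_inner \<Rightarrow> 'a) \<Rightarrow> 'a \<Rightarrow> 'a \<Rightarrow> complex"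
  where "A_inner A x y = cinner (A x) y"

text \<open>For positive \<open>A\<close> the number \<open>A_inner A x x\<close> is real, so taking \<open>Re\<close> loses nothing.\<close>

definition A_seminorm :: "('a::complex_inner \<Rightarrow> 'a) \<Rightarrow> 'a \<Rightarrow> real"
  where "A_seminorm A x = sqrt (Re (A_inner A x x))"

definition A_bounded_operators :: "('a::complex_inner \<Rightarrow> 'a) \<Rightarrow> ('a \<Rightarrow> 'a) set"
  where "A_bounded_operators A =
    {T. bounded_clinear T \<and> (\<exists>l>0. \<forall>x. A_seminorm A (T x) \<le> l * A_seminorm A x)}"

text \<open>
  For \<open>A \<noteq> 0\<close> positive and \<open>T \<in> A_bounded_operators A\<close>, the suprema and infima of reals
  below that define \<open>A_opnorm\<close>, \<open>A_spectral_radius\<close>, \<open>A_numerical_radius\<close> and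
  \<open>A_max_numerical_radius\<close> are all taken over nonempty bounded sets.
\<close>

definition A_opnorm :: "('a::complex_inner \<Rightarrow> 'a) \<Rightarrow> ('a \<Rightarrow> 'a) \<Rightarrow> real"
  where "A_opnorm A T =
    Sup {A_seminorm A (T x) / A_seminorm A x | x. x \<in> closure (range A) \<and> x \<noteq> 0}"

definition A_spectral_radius :: "('a::complex_inner \<Rightarrow> 'a) \<Rightarrow> ('a \<Rightarrow> 'a) \<Rightarrow> real"
  where "A_spectral_radius A T = Inf {root n (A_opnorm A (T ^^ n)) | n. n \<ge> 1}"

definition A_numerical_radius :: "('a::complex_inner \<Rightarrow> 'a) \<Rightarrow> ('a \<Rightarrow> 'a) \<Rightarrow> real"
  where "A_numerical_radius A T = Sup {cmod (A_inner A (T x) x) | x. A_seminorm A x = 1}"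

definition A_normaloid :: "('a::complex_inner \<Rightarrow> 'a) \<Rightarrow> ('a \<Rightarrow> 'a) \<Rightarrow> bool"
  where "A_normaloid A T \<longleftrightarrow>
    T \<in> A_bounded_operators A \<and> A_spectral_radius A T = A_opnorm A T"

definition A_max_numerical_range ::
    "('a::complex_inner \<Rightarrow> 'a) \<Rightarrow> ('a \<Rightarrow> 'a) \<Rightarrow> complex set"
  where "A_max_numerical_range A T =
    {l. \<exists>x :: nat \<Rightarrow> 'a. (\<forall>n. A_seminorm A (x n) = 1) \<and>
        (\<lambda>n. A_inner A (T (x n)) (x n)) \<longlonglongrightarrow> l \<and>
        (\<lambda>n. A_seminorm A (T (x n))) \<longlonglongrightarrow> A_opnorm A T}"

definition A_max_numerical_radius :: "('a::complex_inner \<Rightarrow> 'a) \<Rightarrow> ('a \<Rightarrow> 'a) \<Rightarrow> real"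
  where "A_max_numerical_radius A T = Sup {cmod l | l. l \<in> A_max_numerical_range A T}"

end

theory Submission
  imports Defs
begin

text \<open>
  The range of \<open>A\<close> is dense for the seminorm, so \<open>\<parallel>T\<parallel>\<^sub>A\<close> is the best constant on the whole space,
  and \<open>T\<close> is \<open>A\<close>-normaloid iff \<open>\<parallel>T\<parallel>\<^sub>A\<^sup>n \<le> \<parallel>T\<^sup>n\<parallel>\<^sub>A\<close> for all \<open>n\<close>. If this holds, the power inequality
  \<open>\<omega>(T\<^sup>m) \<le> \<omega>(T)\<^sup>m\<close> for \<open>m = 2\<^sup>k\<close> and \<open>\<parallel>S\<parallel> \<le> 2 \<omega>(S)\<close> give \<open>\<parallel>T\<parallel> = \<omega>(T)\<close>, so a sequence maximizing
  \<open>\<bar>\<langle>T x, x\<rangle>\<bar>\<close> also maximizes \<open>\<parallel>T x\<parallel>\<close>. Conversely, rotate \<open>T\<close> so that unit vectors \<open>x\<^sub>n\<close> satisfy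
  \<open>\<langle>T x\<^sub>n, x\<^sub>n\<rangle> \<rightarrow> \<omega>(T)\<close> and \<open>\<parallel>T x\<^sub>n\<parallel> \<rightarrow> \<parallel>T\<parallel>\<close>. Then the real part of \<open>\<langle>T\<^sup>k x\<^sub>n, x\<^sub>n\<rangle>\<close> tends to
  the real part of \<open>z\<^sup>k\<close> for some \<open>z\<close> with \<open>\<bar>z\<bar> = \<parallel>T\<parallel>\<close>; the duplication formula for the cosine turns
  this into \<open>\<parallel>T\<^sup>n\<parallel> \<ge> \<parallel>T\<parallel>\<^sup>n\<close>.
\<close>

section \<open>Real positive semidefinite forms\<close>

text \<open>For \<open>c > 0\<close> evaluate at the vertex \<open>t = b / c\<close>. The case
  \<open>c = 0\<close> is included because the forms below may be degenerate.\<close>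

lemma discriminant_nonpos:
  fixes a b c :: real
  assumes nonneg: "\<And>t. 0 \<le> a - 2 * t * b + t\<^sup>2 * c" and "0 \<le> c"
  shows "b\<^sup>2 \<le> a * c"
proof (cases "c = 0")
  case True
  have "b = 0"
  proof (rule ccontr)
    assume "b \<noteq> 0"
    \<comment> \<open>With \<open>c = 0\<close> the expression is affine in \<open>t\<close>, and
      this \<open>t\<close> makes it equal to \<open>-1\<close>.\<close>
    then show False
      using nonneg[of "(a + 1) / (2 * b)"] True by (simp add: field_simps)
  qed
  then show ?thesis using True by simp
next
  case False
  then have "c > 0" using assms by simp
  have "0 \<le> c * (a - 2 * (b / c) * b + (b / c)\<^sup>2 * c)"
    using nonneg[of "b / c"] \<open>c > 0\<close> by (intro mult_nonneg_nonneg) auto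
  also have "\<dots> = a * c - b\<^sup>2"
    using \<open>c > 0\<close> by (simp add: field_simps power2_eq_square)
  finally show ?thesis by simp
qed

text \<open>A constant factor disappears under \<open>n\<close>-th roots, so infinitely many
  exponents are enough; below these are even numbers or powers of two.\<close>

lemma le_if_power_le_mult_power:
  fixes p q K :: real
  assumes "0 \<le> p" "0 \<le> q" and le: "\<And>N. \<exists>n\<ge>N. p ^ n \<le> K * q ^ n"
  shows "p \<le> q"
proof (rule ccontr)
  assume "\<not> p \<le> q"
  then have "q < p" "p > 0" using assms by auto
  then have "(\<lambda>n. K * (q / p) ^ n) \<longlonglongrightarrow> K * 0"
    using assms by (intro tendsto_mult tendsto_const LIMSEQ_realpow_zero) auto
  then have "eventually (\<lambda>n. K * (q / p) ^ n < 1) sequentially"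
    by (intro order_tendstoD(2)) auto
  then obtain N where N: "\<And>n. n \<ge> N \<Longrightarrow> K * (q / p) ^ n < 1"
    by (auto simp: eventually_sequentially)
  obtain n where "n \<ge> N" "p ^ n \<le> K * q ^ n" using le by blast
  then show False
    using N[of n] \<open>p > 0\<close> by (simp add: power_divide field_simps)
qed

text \<open>Semidefinite and real, so that the real part of the semi-inner product and the defect
  forms \<open>B\<close> and \<open>C\<close> of an operator are all instances and inherit
  Cauchy--Schwarz.\<close>

locale psd_form =
  fixes b :: "'a::real_vector \<Rightarrow> 'a \<Rightarrow> real"
  assumes add_left: "b (x + y) z = b x z + b y z"
    and scaleR_left: "b (r *\<^sub>R x) z = r * b x z"
    and commute: "b x y = b y x"
    and nonneg: "0 \<le> b x x"
begin

lemma add_right: "b z (x + y) = b z x + b z y"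
  using add_left commute by metis

lemma scaleR_right: "b z (r *\<^sub>R x) = r * b z x"
  using scaleR_left commute by metis

lemma minus_left: "b (- x) z = - b x z"
  using scaleR_left[of "-1" x z] by simp

lemma minus_right: "b z (- x) = - b z x"
  using minus_left commute by metis

lemma diff_left: "b (x - y) z = b x z - b y z"
  using add_left[of x "- y" z] minus_left by simp

lemma diff_right: "b z (x - y) = b z x - b z y"
  using diff_left commute by metis

lemmas expand = add_left add_right scaleR_left scaleR_right minus_left minus_right
  diff_left diff_right

lemma Cauchy_Schwarz: "(b x y)\<^sup>2 \<le> b x x * b y y"
proof (rule discriminant_nonpos)
  show "0 \<le> b x x - 2 * t * b x y + t\<^sup>2 * b y y" for t
    using nonneg[of "x - t *\<^sub>R y"] commute[of x y]
    by (simp add: expand power2_eq_square algebra_simps)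
qed (rule nonneg)

lemma Cauchy_Schwarz_abs: "\<bar>b x y\<bar> \<le> sqrt (b x x) * sqrt (b y y)"
  using Cauchy_Schwarz[of x y] real_sqrt_le_mono by (fastforce simp: real_sqrt_mult)

lemma triangle: "sqrt (b (x + y) (x + y)) \<le> sqrt (b x x) + sqrt (b y y)"
proof (rule real_le_lsqrt)
  show "b (x + y) (x + y) \<le> (sqrt (b x x) + sqrt (b y y))\<^sup>2"
    using Cauchy_Schwarz_abs[of x y] commute[of y x] nonneg[of x] nonneg[of y]
    by (simp add: expand power2_sum)
qed (auto simp: nonneg)

lemma tendsto_form_zero:
  assumes "(\<lambda>n. b (x n) (x n)) \<longlonglongrightarrow> 0" and "\<And>n. b (y n) (y n) \<le> K"
  shows "(\<lambda>n. b (x n) (y n)) \<longlonglongrightarrow> 0"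
proof -
  have "norm (b (x n) (y n)) \<le> sqrt (b (x n) (x n)) * sqrt K" for n
    using Cauchy_Schwarz_abs[of "x n" "y n"] assms(2)[of n] nonneg[of "x n"]
      mult_left_mono[OF real_sqrt_le_mono[OF assms(2)[of n]], of "sqrt (b (x n) (x n))"]
    by auto
  moreover have "(\<lambda>n. sqrt (b (x n) (x n)) * sqrt K) \<longlonglongrightarrow> 0"
    using tendsto_mult[OF tendsto_real_sqrt[OF assms(1)] tendsto_const[of "sqrt K"]] by simp
  ultimately show ?thesis
    by (intro Lim_null_comparison[OF _ \<open>(\<lambda>n. sqrt (b (x n) (x n)) * sqrt K) \<longlonglongrightarrow> 0\<close>]) auto
qed

lemma funpow_form_le:
  assumes "\<And>x. b (S x) (S x) \<le> m * b x x" and "0 \<le> m"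
  shows "b ((S ^^ k) x) ((S ^^ k) x) \<le> m ^ k * b x x"
proof (induction k)
  case (Suc k)
  have "b ((S ^^ Suc k) x) ((S ^^ Suc k) x) \<le> m * b ((S ^^ k) x) ((S ^^ k) x)"
    using assms(1) by simp
  also have "\<dots> \<le> m * (m ^ k * b x x)" using Suc assms(2) by (intro mult_left_mono)
  finally show ?case by (simp add: mult.assoc)
qed simp

text \<open>
  The forms \<open>w - Re S\<close> and \<open>m\<^sup>2 - S\<^sup>* S\<close> are positive and vanish asymptotically on
  \<open>x n\<close>, so by Cauchy--Schwarz they vanish against every bounded sequence. Testing them
  against the powers of \<open>S\<close> shows that the limits of \<open>b (S\<^sup>k (x n)) (x n)\<close> satisfy the
  recurrence \<open>a\<^bsub>k+2\<^esub> = 2 w a\<^bsub>k+1\<^esub> - m\<^sup>2 a\<^bsub>k\<^esub>\<close>, whose characteristic roots have modulus \<open>m\<close>.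
\<close>

lemma tendsto_funpow_form:
  fixes x :: "nat \<Rightarrow> 'a"
  assumes S: "linear S" and "0 \<le> m" and bound: "\<And>x. b (S x) (S x) \<le> m\<^sup>2 * b x x"
    and radius: "\<And>x. b (S x) x \<le> w * b x x"
    and unit: "\<And>n. b (x n) (x n) = 1"
    and lim_w: "(\<lambda>n. b (S (x n)) (x n)) \<longlonglongrightarrow> w"
    and lim_m: "(\<lambda>n. b (S (x n)) (S (x n))) \<longlonglongrightarrow> m\<^sup>2"
    and z: "Re z = w" "cmod z = m"
  shows "(\<lambda>n. b ((S ^^ k) (x n)) (x n)) \<longlonglongrightarrow> Re (z ^ k)"
proof -
  define B where "B x y = 2 * w * b x y - b (S x) y - b x (S y)" for x y
  define C where "C x y = m\<^sup>2 * b x y - b (S x) (S y)" for x y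
  interpret B: psd_form B
    by unfold_locales
      (use radius commute in \<open>auto simp: B_def expand linear_add[OF S] linear_scale[OF S] algebra_simps\<close>)
  interpret C: psd_form C
    by unfold_locales
      (use bound commute in \<open>auto simp: C_def expand linear_add[OF S] linear_scale[OF S] algebra_simps\<close>)
  have bounded: "b ((S ^^ k) (x n)) ((S ^^ k) (x n)) \<le> (m\<^sup>2) ^ k" for k n
    using funpow_form_le[OF bound, of k "x n"] unit[of n] by simp
  have w_le: "\<bar>w\<bar> \<le> m" using z abs_Re_le_cmod by blast
  have form_S: "\<bar>b (S y) y\<bar> \<le> m * b y y" for y
  proof -
    have "sqrt (b (S y) (S y)) \<le> m * sqrt (b y y)"
      using real_sqrt_le_mono[OF bound[of y]] \<open>0 \<le> m\<close> by (simp add: real_sqrt_mult)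
    then have "\<bar>b (S y) y\<bar> \<le> (m * sqrt (b y y)) * sqrt (b y y)"
      using Cauchy_Schwarz_abs[of "S y" y] mult_right_mono nonneg[of y] real_sqrt_ge_zero
      by (meson order_trans)
    then show ?thesis using nonneg[of y] by (simp add: mult.assoc)
  qed
  \<comment> \<open>The term with \<open>2 * w\<close> contributes at most \<open>2 * m\<close>,
    each of the two cross terms at most \<open>m\<close>.\<close>
  have "B y y \<le> 4 * m * b y y" for y
    using form_S[of y] mult_right_mono[OF w_le nonneg[of y]] commute[of "S y" y] nonneg[of y]
      mult_right_mono[OF abs_ge_self[of w] nonneg[of y]]
    unfolding B_def by linarith
  moreover have "4 * m * b ((S ^^ k) (x n)) ((S ^^ k) (x n)) \<le> 4 * m * (m\<^sup>2) ^ k" for k n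
    using bounded \<open>0 \<le> m\<close> by (intro mult_left_mono) auto
  ultimately have B_bounded: "B ((S ^^ k) (x n)) ((S ^^ k) (x n)) \<le> 4 * m * (m\<^sup>2) ^ k" for k n
    using order_trans by blast
  have "C y y \<le> m\<^sup>2 * b y y" for y
    using nonneg[of "S y"] by (simp add: C_def)
  moreover have "m\<^sup>2 * b ((S ^^ k) (x n)) ((S ^^ k) (x n)) \<le> m\<^sup>2 * (m\<^sup>2) ^ k" for k n
    using bounded by (intro mult_left_mono) auto
  ultimately have C_bounded: "C ((S ^^ k) (x n)) ((S ^^ k) (x n)) \<le> m\<^sup>2 * (m\<^sup>2) ^ k" for k n
    using order_trans by blast
  have "(\<lambda>n. 2 * w * 1 - b (S (x n)) (x n) - b (S (x n)) (x n)) \<longlonglongrightarrow> 2 * w * 1 - w - w"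
    by (intro tendsto_intros lim_w)
  then have "(\<lambda>n. B (x n) (x n)) \<longlonglongrightarrow> 0"
    unfolding B_def by (simp add: unit commute[of "x _" "S _"])
  then have B_lim: "(\<lambda>n. B (x n) ((S ^^ k) (x n))) \<longlonglongrightarrow> 0" for k
    by (rule B.tendsto_form_zero) (rule B_bounded)
  have "(\<lambda>n. m\<^sup>2 * 1 - b (S (x n)) (S (x n))) \<longlonglongrightarrow> m\<^sup>2 * 1 - m\<^sup>2"
    by (intro tendsto_intros lim_m)
  then have "(\<lambda>n. C (x n) (x n)) \<longlonglongrightarrow> 0"
    unfolding C_def by (simp add: unit)
  then have C_lim: "(\<lambda>n. C (x n) ((S ^^ k) (x n))) \<longlonglongrightarrow> 0" for k
    by (rule C.tendsto_form_zero) (rule C_bounded)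
  have "z * z = 2 * w * z - m\<^sup>2"
  proof -
    have "z + cnj z = 2 * w" "z * cnj z = m\<^sup>2"
      using z by (simp_all add: complex_add_cnj complex_norm_square[symmetric])
    moreover have "z * z = (z + cnj z) * z - z * cnj z" by (simp add: algebra_simps)
    ultimately show ?thesis by simp
  qed
  then have "z ^ Suc (Suc k) = 2 * w * z ^ Suc k - m\<^sup>2 * z ^ k" for k
    by (simp add: left_diff_distrib flip: mult.assoc)
  then have recurrence: "Re (z ^ Suc (Suc k)) = 2 * w * Re (z ^ Suc k) - m\<^sup>2 * Re (z ^ k)" for k
    by (simp only: minus_complex.simps Re_complex_of_real) (simp flip: of_real_power)
  show ?thesis
  proof (induction k rule: induct_nat_012)
    case 0
    then show ?case by (simp add: unit)
  next
    case 1
    then show ?case using lim_w z by simp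
  next
    case (ge2 k)
    \<comment> \<open>\<open>B\<close> moves one factor \<open>S\<close> to the other argument;
      \<open>C\<close> then replaces the resulting \<open>b (S x) (S y)\<close> by
      \<open>m\<^sup>2 * b x y\<close>. Both error terms tend to 0.\<close>
    have "b ((S ^^ Suc (Suc k)) (x n)) (x n) =
        2 * w * b ((S ^^ Suc k) (x n)) (x n)
        - (m\<^sup>2 * b ((S ^^ k) (x n)) (x n) - C (x n) ((S ^^ k) (x n)))
        - B (x n) ((S ^^ Suc k) (x n))" for n
      using commute[of "x n"] by (simp add: B_def C_def)
    moreover have "(\<lambda>n. 2 * w * b ((S ^^ Suc k) (x n)) (x n)
        - (m\<^sup>2 * b ((S ^^ k) (x n)) (x n) - C (x n) ((S ^^ k) (x n)))
        - B (x n) ((S ^^ Suc k) (x n)))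
      \<longlonglongrightarrow> 2 * w * Re (z ^ Suc k) - (m\<^sup>2 * Re (z ^ k) - 0) - 0"
      by (intro tendsto_intros ge2 B_lim C_lim)
    ultimately show ?case by (simp add: recurrence del: funpow.simps power_Suc)
  qed
qed

text \<open>Along the extremal sequence the powers of \<open>S ^^ n\<close> have the limits
  \<open>Re (u ^ j)\<close> with \<open>u = z ^ n\<close>, and the bound on \<open>S ^^ n\<close>
  makes these at most \<open>q ^ j\<close> in modulus. Real parts of all powers control
  \<open>cmod u = m ^ n\<close>, whatever the argument of \<open>u\<close>.\<close>

lemma power_le_if_extremal:
  fixes x :: "nat \<Rightarrow> 'a"
  assumes S: "linear S" and "0 \<le> m" and bound: "\<And>x. b (S x) (S x) \<le> m\<^sup>2 * b x x"
    and radius: "\<And>x. b (S x) x \<le> w * b x x"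
    and unit: "\<And>n. b (x n) (x n) = 1"
    and lim_w: "(\<lambda>n. b (S (x n)) (x n)) \<longlonglongrightarrow> w"
    and lim_m: "(\<lambda>n. b (S (x n)) (S (x n))) \<longlonglongrightarrow> m\<^sup>2"
    and "0 \<le> q" and q: "\<And>x. b ((S ^^ n) x) ((S ^^ n) x) \<le> q\<^sup>2 * b x x"
  shows "m ^ n \<le> q"
proof -
  have "(b (S (x n)) (x n))\<^sup>2 \<le> m\<^sup>2" for n
    using Cauchy_Schwarz[of "S (x n)" "x n"] bound[of "x n"] unit[of n] by simp
  then have "w\<^sup>2 \<le> m\<^sup>2"
    using tendsto_power[OF lim_w, of 2] by (intro LIMSEQ_le_const2) auto
  \<comment> \<open>A root of the characteristic polynomial
    \<open>t\<^sup>2 - 2 * w * t + m\<^sup>2\<close>; \<open>w\<^sup>2 \<le> m\<^sup>2\<close> keeps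
    the radicand nonnegative and gives \<open>z\<close> modulus \<open>m\<close>.\<close>
  define z where "z = Complex w (sqrt (m\<^sup>2 - w\<^sup>2))"
  have z: "Re z = w" "cmod z = m"
    using \<open>w\<^sup>2 \<le> m\<^sup>2\<close> \<open>0 \<le> m\<close> by (auto simp: z_def cmod_def)
  define u where "u = z ^ n"
  have abs_u: "cmod u = m ^ n" by (simp add: u_def norm_power z)
  have Re_u: "\<bar>Re (u ^ j)\<bar> \<le> q ^ j" for j
  proof -
    have "\<bar>b ((S ^^ (n * j)) (x i)) (x i)\<bar> \<le> q ^ j" for i
    proof -
      have "b (((S ^^ n) ^^ j) (x i)) (((S ^^ n) ^^ j) (x i)) \<le> (q\<^sup>2) ^ j * b (x i) (x i)"
        by (rule funpow_form_le) (auto simp: q)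
      then have "b ((S ^^ (n * j)) (x i)) ((S ^^ (n * j)) (x i)) \<le> (q ^ j)\<^sup>2"
        by (simp add: unit funpow_mult mult.commute flip: power_mult)
      then have "(b ((S ^^ (n * j)) (x i)) (x i))\<^sup>2 \<le> (q ^ j)\<^sup>2"
        using Cauchy_Schwarz[of "(S ^^ (n * j)) (x i)" "x i"] by (simp add: unit)
      then show ?thesis using \<open>0 \<le> q\<close> by (simp add: abs_le_square_iff[symmetric])
    qed
    moreover have "(\<lambda>i. b ((S ^^ (n * j)) (x i)) (x i)) \<longlonglongrightarrow> Re (z ^ (n * j))"
      using tendsto_funpow_form[OF S \<open>0 \<le> m\<close> bound radius unit lim_w lim_m z] .
    ultimately show ?thesis
      unfolding u_def power_mult[symmetric] by (intro LIMSEQ_le_const2[OF tendsto_rabs]) auto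
  qed
  \<comment> \<open>The duplication formula shows that the real parts of \<open>u ^ j\<close> and
    \<open>u ^ (2 * j)\<close> cannot both be small; they contribute 2 and 1 to the constant
    3.\<close>
  have "(m ^ n) ^ (2 * j) \<le> 3 * q ^ (2 * j)" for j
  proof -
    have "Re (u ^ (2 * j)) = 2 * (Re (u ^ j))\<^sup>2 - (cmod (u ^ j))\<^sup>2"
      unfolding cmod_power2 by (simp add: mult.commute[of 2] power_mult power2_eq_square)
    moreover have "(cmod (u ^ j))\<^sup>2 = (m ^ n) ^ (2 * j)"
      by (simp add: norm_power abs_u mult_ac flip: power_mult)
    moreover have "(Re (u ^ j))\<^sup>2 \<le> q ^ (2 * j)"
      using power_mono[OF Re_u[of j], of 2] by (simp add: power_mult[symmetric] mult.commute)
    ultimately show ?thesis using Re_u[of "2 * j"] by linarith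
  qed
  then have "\<exists>i\<ge>N. (m ^ n) ^ i \<le> 3 * q ^ i" for N by (intro exI[of _ "2 * N"]) simp
  then show ?thesis
    by (intro le_if_power_le_mult_power[where K = 3 and p = "m ^ n" and q = q])
      (simp_all add: \<open>0 \<le> m\<close> \<open>0 \<le> q\<close>)
qed

end

section \<open>The semi-inner product of a positive operator\<close>

lemma exists_unimodular_mult:
  obtains c where "cmod c = 1" "c * z = complex_of_real (cmod z)"
proof (cases "z = 0")
  case True
  then show ?thesis using that[of 1] by simp
next
  case False
  have "cnj z / cmod z * z = complex_of_real (cmod z)"
    using False by (simp add: field_simps complex_norm_square[symmetric] power2_eq_square)
  moreover have "cmod (cnj z / cmod z) = 1"
    using False by (simp add: norm_divide)
  ultimately show ?thesis using that by blast
qed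

lemma cinner_add_right: "cinner (x::'a::complex_inner) (y + z) = cinner x y + cinner x z"
  by (metis cinner_add_left cinner_commute complex_cnj_add)

lemma cinner_scaleC_right: "cinner (x::'a::complex_inner) (a *\<^sub>C y) = cnj a * cinner x y"
  by (metis cinner_commute cinner_scaleC_left complex_cnj_mult)

lemma bounded_clinear_linear: "bounded_clinear T \<Longrightarrow> linear T"
  by (simp add: bounded_clinear_def bounded_linear.linear)

lemma bounded_clinear_scaleC: "bounded_clinear T \<Longrightarrow> T (c *\<^sub>C x) = c *\<^sub>C T x"
  by (simp add: bounded_clinear_def)

lemma bounded_clinear_funpow:
  assumes "bounded_clinear T"
  shows "bounded_clinear (T ^^ n)"
proof (induction n)
  case 0
  then show ?case by (simp add: bounded_clinear_def id_def)
next
  case (Suc n)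
  then show ?case
    using assms bounded_linear_compose[of T "T ^^ n"] by (simp add: bounded_clinear_def comp_def)
qed

lemma bounded_linear_scaleC: "bounded_linear (\<lambda>x::'a::complex_inner. c *\<^sub>C x)"
proof
  show "c *\<^sub>C (x + y) = c *\<^sub>C x + c *\<^sub>C y" for x y :: 'a
    by (rule scaleC_add_right)
  show "c *\<^sub>C (r *\<^sub>R x) = r *\<^sub>R (c *\<^sub>C x)" for r and x :: 'a
    by (simp add: scaleR_scaleC scaleC_scaleC mult.commute)
  show "\<exists>K. \<forall>x::'a. norm (c *\<^sub>C x) \<le> norm x * K"
  proof (intro exI allI)
    fix x :: 'a
    have "cinner (c *\<^sub>C x) (c *\<^sub>C x) = complex_of_real ((norm x * cmod c)\<^sup>2)"
      unfolding cinner_scaleC_left cinner_scaleC_right cinner_self[of x] power_mult_distrib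
        of_real_mult complex_norm_square by (simp add: mult_ac)
    then have "(norm (c *\<^sub>C x))\<^sup>2 = (norm x * cmod c)\<^sup>2"
      unfolding cinner_self of_real_eq_iff .
    then show "norm (c *\<^sub>C x) \<le> norm x * cmod c"
      by (simp add: power2_eq_iff_nonneg)
  qed
qed

lemma bounded_clinear_scaleC_comp:
  assumes "bounded_clinear T"
  shows "bounded_clinear (\<lambda>x. c *\<^sub>C T x)"
  using assms bounded_linear_compose[OF bounded_linear_scaleC, of T c]
  by (simp add: bounded_clinear_def scaleC_scaleC mult.commute)

lemma funpow_scaleC:
  assumes "bounded_clinear T"
  shows "((\<lambda>x. c *\<^sub>C T x) ^^ n) x = (c ^ n) *\<^sub>C (T ^^ n) x"
proof (induction n)
  case 0
  then show ?case by (simp add: scaleC_one)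
next
  case (Suc n)
  have "((\<lambda>x. c *\<^sub>C T x) ^^ Suc n) x = c *\<^sub>C T ((c ^ n) *\<^sub>C (T ^^ n) x)"
    by (simp add: Suc)
  also have "\<dots> = (c ^ Suc n) *\<^sub>C (T ^^ Suc n) x"
    by (simp add: bounded_clinear_scaleC[OF assms] scaleC_scaleC)
  finally show ?case .
qed

section \<open>Hermitian symmetry, Cauchy--Schwarz and density of the range\<close>

locale semi_Hilbertian =
  fixes A :: "'a::complex_inner \<Rightarrow> 'a"
  assumes positive: "positive_operator A" and nonzero: "A \<noteq> (\<lambda>x. 0)"
begin

abbreviation P where "P \<equiv> A_seminorm A"
abbreviation Q where "Q \<equiv> A_inner A"
abbreviation b where "b x y \<equiv> Re (A_inner A x y)"

lemma bounded_clinear_A: "bounded_clinear A"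
  using positive by (simp add: positive_operator_def)

lemma A_add: "A (x + y) = A x + A y"
  using bounded_clinear_linear[OF bounded_clinear_A] by (rule linear_add)

lemma Q_add_left: "Q (x + y) z = Q x z + Q y z"
  by (simp add: A_inner_def A_add cinner_add_left)

lemma Q_add_right: "Q z (x + y) = Q z x + Q z y"
  by (simp add: A_inner_def cinner_add_right)

lemma Q_scaleC_left: "Q (c *\<^sub>C x) y = c * Q x y"
  by (simp add: A_inner_def bounded_clinear_scaleC[OF bounded_clinear_A] cinner_scaleC_left)

lemma Q_scaleC_right: "Q x (c *\<^sub>C y) = cnj c * Q x y"
  by (simp add: A_inner_def cinner_scaleC_right)

lemma Q_diff_left: "Q (x - y) z = Q x z - Q y z"
  using Q_add_left[of "x - y" y z] by simp

lemma Q_diff_right: "Q z (x - y) = Q z x - Q z y"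
  using Q_add_right[of z "x - y" y] by simp

lemma Q_nonneg: "Q x x \<in> \<real>\<^sub>\<ge>\<^sub>0"
  using positive by (simp add: positive_operator_def A_inner_def)

lemma Im_Q_self: "Im (Q x x) = 0"
  using Q_nonneg[of x] by (auto simp: complex_nonneg_Reals_iff)

text \<open>Positivity makes the quadratic form real; over complex scalars, polarization with
  \<open>x + y\<close> and \<open>x + \<i> *\<^sub>C y\<close> turns this into self-adjointness of
  \<open>A\<close>.\<close>

lemma Q_commute: "Q x y = cnj (Q y x)"
proof -
  have "Im (Q (x + y) (x + y)) = 0" "Im (Q (x + \<i> *\<^sub>C y) (x + \<i> *\<^sub>C y)) = 0"
    by (rule Im_Q_self)+
  then show ?thesis
    using Im_Q_self[of x] Im_Q_self[of y]
    by (simp add: complex_eq_iff Q_add_left Q_add_right Q_scaleC_left Q_scaleC_right)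
qed

sublocale psd_form b
proof
  show "0 \<le> b x x" for x using Q_nonneg[of x] by (auto simp: complex_nonneg_Reals_iff)
  show "b x y = b y x" for x y by (subst Q_commute) simp
qed (simp_all add: Q_add_left scaleR_scaleC Q_scaleC_left)

lemma P_power2: "(P x)\<^sup>2 = b x x"
  by (simp add: A_seminorm_def nonneg)

lemma P_nonneg: "0 \<le> P x"
  by (simp add: A_seminorm_def nonneg)

lemma P_triangle: "P (x + y) \<le> P x + P y"
  unfolding A_seminorm_def by (rule triangle)

lemma P_scaleC: "P (c *\<^sub>C x) = cmod c * P x"
proof -
  have "Q (c *\<^sub>C x) (c *\<^sub>C x) = complex_of_real ((cmod c)\<^sup>2) * Q x x"
    unfolding Q_scaleC_left Q_scaleC_right complex_norm_square by (simp add: mult.commute)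
  then show ?thesis by (simp add: A_seminorm_def real_sqrt_mult)
qed

lemma P_scaleR: "P (r *\<^sub>R x) = \<bar>r\<bar> * P x"
  by (simp add: scaleR_scaleC P_scaleC)

text \<open>The real Cauchy--Schwarz inequality, after rotating \<open>x\<close> so that
  \<open>Q x y\<close> becomes its modulus.\<close>

lemma cmod_Q_le: "cmod (Q x y) \<le> P x * P y"
proof -
  obtain c where c: "cmod c = 1" "c * Q x y = complex_of_real (cmod (Q x y))"
    by (rule exists_unimodular_mult)
  have "cmod (Q x y) = b (c *\<^sub>C x) y" by (simp add: Q_scaleC_left c)
  also have "\<dots> \<le> P (c *\<^sub>C x) * P y"
    using Cauchy_Schwarz_abs[of "c *\<^sub>C x" y] by (simp add: A_seminorm_def)
  finally show ?thesis by (simp add: P_scaleC c)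
qed

lemma exists_unit: obtains x where "P x = 1"
proof -
  obtain x where "A x \<noteq> 0" using nonzero by blast
  have "P x \<noteq> 0"
  proof
    assume "P x = 0"
    \<comment> \<open>\<open>Q x (A x)\<close> is the squared norm of \<open>A x\<close>, so the
      seminorm vanishes only on the kernel of \<open>A\<close>.\<close>
    then have "Q x (A x) = 0" using cmod_Q_le[of x "A x"] by simp
    then show False using \<open>A x \<noteq> 0\<close> by (simp add: A_inner_def cinner_self)
  qed
  then have "P ((1 / P x) *\<^sub>R x) = 1" using P_nonneg[of x] by (simp add: P_scaleR)
  then show ?thesis by (rule that)
qed

text \<open>
  An almost minimizer \<open>u = x - A z\<close> of the seminorm is almost orthogonal to \<open>range A\<close>. Testing
  against \<open>A u\<close> makes \<open>A u\<close> small, testing against \<open>A z\<close> then makes \<open>P u\<close> small. This avoids the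
  projection theorem.
\<close>

lemma range_dense:
  assumes "0 < e"
  obtains z where "P (x - A z) < e"
proof -
  define f where "f z = b (x - A z) (x - A z)" for z
  define d where "d = Inf (range f)"
  have "bdd_below (range f)" by (rule bdd_belowI[of _ 0]) (auto simp: f_def nonneg)
  then have d_le: "d \<le> f z" for z unfolding d_def by (intro cInf_lower) auto
  obtain K where K: "K > 0" "\<And>y. norm (A y) \<le> norm y * K"
    using bounded_clinear_A bounded_linear.pos_bounded unfolding bounded_clinear_def by blast
  note lin = bounded_clinear_linear[OF bounded_clinear_A]
  \<comment> \<open>\<open>f z\<close> will be \<open>b u x - b u (A z)\<close>; the two summands of
    \<open>C\<close> bound these terms up to the factor \<open>sqrt \<epsilon>\<close>.\<close>
  define C where "C = sqrt K * norm x + sqrt (4 * b x x + 2)"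
  have "d \<le> sqrt \<epsilon> * C" if \<epsilon>: "0 < \<epsilon>" "\<epsilon> \<le> 1" for \<epsilon>
  proof -
    have "\<exists>y\<in>range f. y < d + \<epsilon>"
      unfolding d_def using \<epsilon> cInf_lessD[of "range f" "Inf (range f) + \<epsilon>"] by auto
    then obtain z where z: "f z < d + \<epsilon>" by auto
    define u where "u = x - A z"
    have orth: "(b u (A y))\<^sup>2 \<le> \<epsilon> * b (A y) (A y)" for y
    proof (rule discriminant_nonpos)
      fix t
      have "d \<le> f (z + t *\<^sub>R y)" by (rule d_le)
      also have "f (z + t *\<^sub>R y) = b (u - t *\<^sub>R A y) (u - t *\<^sub>R A y)"
        by (simp add: f_def u_def linear_add[OF lin] linear_scale[OF lin] diff_diff_eq)
      also have "\<dots> = f z - 2 * t * b u (A y) + t\<^sup>2 * b (A y) (A y)"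
        using commute[of u "A y"]
        by (simp add: expand f_def power2_eq_square algebra_simps flip: u_def)
      finally show "0 \<le> \<epsilon> - 2 * t * b u (A y) + t\<^sup>2 * b (A y) (A y)" using z by linarith
    qed (rule nonneg)
    have "b u (A u) = (norm (A u))\<^sup>2"
      by (simp add: A_inner_def cinner_self flip: of_real_power)
    moreover have "b (A u) (A u) \<le> K * (norm (A u))\<^sup>2"
    proof -
      have "b (A u) (A u) = inner (A (A u)) (A u)" by (simp add: A_inner_def inner_eq_Re_cinner)
      also have "\<dots> \<le> norm (A (A u)) * norm (A u)" by (rule norm_cauchy_schwarz)
      also have "\<dots> \<le> (norm (A u) * K) * norm (A u)" by (intro mult_right_mono K) auto
      finally show ?thesis by (simp add: power2_eq_square mult_ac)
    qed
    ultimately have "((norm (A u))\<^sup>2)\<^sup>2 \<le> \<epsilon> * (K * (norm (A u))\<^sup>2)"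
      using orth[of u] \<epsilon> by (smt (verit) mult_left_mono)
    then have "(norm (A u))\<^sup>2 * (norm (A u))\<^sup>2 \<le> (\<epsilon> * K) * (norm (A u))\<^sup>2"
      by (simp add: power2_eq_square[of "(norm (A u))\<^sup>2"] mult.assoc)
    then have "(norm (A u))\<^sup>2 \<le> \<epsilon> * K"
      by (cases "A u = 0")
        (use \<epsilon> K in simp, metis mult_right_le_imp_le zero_less_norm_iff zero_less_power)
    then have Au: "norm (A u) \<le> sqrt \<epsilon> * sqrt K"
      unfolding real_sqrt_mult[symmetric] by (rule real_le_rsqrt)
    have "b u x = inner (A u) x" by (simp add: A_inner_def inner_eq_Re_cinner)
    also have "\<dots> \<le> norm (A u) * norm x" by (rule norm_cauchy_schwarz)
    also have "\<dots> \<le> sqrt \<epsilon> * sqrt K * norm x" by (intro mult_right_mono Au) auto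
    finally have bux: "b u x \<le> sqrt \<epsilon> * sqrt K * norm x" .
    have "f 0 = b x x" by (simp add: f_def linear_0[OF lin])
    then have "f z \<le> b x x + 1" using z d_le[of 0] \<epsilon> by linarith
    \<comment> \<open>The parallelogram law for \<open>x\<close> and \<open>u\<close>:
      \<open>A z\<close> is \<open>x - u\<close>, and the nonnegative square of
      \<open>2 *\<^sub>R x - A z = x + u\<close> is dropped.\<close>
    moreover have "b (A z) (A z) \<le> 2 * b x x + 2 * f z"
      using nonneg[of "2 *\<^sub>R x - A z"] commute[of x "A z"] unfolding f_def
      by (simp add: expand)
    ultimately have "b (A z) (A z) \<le> 4 * b x x + 2" by linarith
    then have "(b u (A z))\<^sup>2 \<le> \<epsilon> * (4 * b x x + 2)"
      using orth[of z] \<epsilon> by (smt (verit) mult_left_mono)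
    then have "\<bar>b u (A z)\<bar> \<le> sqrt \<epsilon> * sqrt (4 * b x x + 2)"
      unfolding real_sqrt_mult[symmetric] by (intro real_le_rsqrt) simp
    then have "b u x - b u (A z) \<le> sqrt \<epsilon> * C" using bux by (simp add: C_def algebra_simps)
    then have "f z \<le> sqrt \<epsilon> * C" by (simp add: f_def diff_right u_def)
    then show ?thesis using d_le[of z] by linarith
  qed
  then have "\<exists>N. \<forall>n\<ge>N. d \<le> sqrt (inverse (real (Suc n))) * C"
    by (simp add: inverse_le_1_iff)
  moreover have "(\<lambda>n. sqrt (inverse (real (Suc n))) * C) \<longlonglongrightarrow> sqrt 0 * C"
    by (intro tendsto_intros LIMSEQ_inverse_real_of_nat)
  ultimately have "d \<le> 0" using LIMSEQ_le_const by fastforce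
  then have "\<exists>y\<in>range f. y < e\<^sup>2"
    using cInf_lessD[of "range f" "e\<^sup>2"] assms unfolding d_def
    by (metis UNIV_not_empty image_is_empty order_le_less_trans zero_less_power)
  then obtain z where "f z < e\<^sup>2" by auto
  then have "P (x - A z) < e"
    using assms unfolding f_def A_seminorm_def by (intro real_less_lsqrt) (auto simp: nonneg)
  then show ?thesis by (rule that)
qed

section \<open>The operator seminorm and the criterion for normaloid operators\<close>

lemma clinear: "T \<in> A_bounded_operators A \<Longrightarrow> bounded_clinear T"
  by (simp add: A_bounded_operators_def)

text \<open>Where \<open>P x = 0\<close> the quotient is 0 by the convention for division, whence
  \<open>0 \<le> l\<close>.\<close>

lemma quotient_le:
  assumes "\<And>x. P (T x) \<le> l * P x" "0 \<le> l"
  shows "P (T x) / P x \<le> l"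
proof (cases "P x = 0")
  case False
  then have "0 < P x" using P_nonneg[of x] by linarith
  then show ?thesis using assms(1)[of x] by (simp only: divide_le_eq if_True)
qed (simp add: assms(2))

lemma opnorm_set_nonempty: "\<exists>x. x \<in> closure (range A) \<and> x \<noteq> 0"
proof -
  obtain x where "A x \<noteq> 0" using nonzero by blast
  moreover have "A x \<in> closure (range A)"
    using closure_subset[of "range A"] by (rule subsetD) simp
  ultimately show ?thesis by (intro exI conjI)
qed

lemma opnorm_le:
  assumes "\<And>x. P (T x) \<le> l * P x" "0 \<le> l"
  shows "A_opnorm A T \<le> l"
  unfolding A_opnorm_def
proof (rule cSup_least)
  show "{P (T x) / P x | x. x \<in> closure (range A) \<and> x \<noteq> 0} \<noteq> {}"
    using opnorm_set_nonempty by blast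
  have "P (T x) / P x \<le> l" for x by (rule quotient_le) (rule assms)+
  then show "y \<le> l" if "y \<in> {P (T x) / P x | x. x \<in> closure (range A) \<and> x \<noteq> 0}" for y
    using that by blast
qed

text \<open>The supremum only sees the closure of \<open>range A\<close>. Since
  \<open>range A\<close> is dense for the seminorm and \<open>T\<close> is continuous for it with
  some constant \<open>l\<close>, the bound extends to every vector.\<close>

lemma
  assumes T: "T \<in> A_bounded_operators A"
  shows opnorm_bound: "P (T x) \<le> A_opnorm A T * P x"
    and opnorm_nonneg: "0 \<le> A_opnorm A T"
proof -
  define M where "M = A_opnorm A T"
  obtain l where l: "l > 0" "\<And>x. P (T x) \<le> l * P x"
    using T unfolding A_bounded_operators_def by blast
  have "bdd_above {P (T x) / P x | x. x \<in> closure (range A) \<and> x \<noteq> 0}"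
  proof (rule bdd_aboveI[of _ l])
    have "P (T x) / P x \<le> l" for x by (rule quotient_le) (use l in \<open>auto intro: less_imp_le\<close>)
    then show "y \<le> l" if "y \<in> {P (T x) / P x | x. x \<in> closure (range A) \<and> x \<noteq> 0}" for y
      using that by blast
  qed
  then have upper: "P (T y) / P y \<le> M" if "y \<in> closure (range A)" "y \<noteq> 0" for y
    unfolding M_def A_opnorm_def using that by (intro cSup_upper) blast+
  obtain y where "y \<in> closure (range A)" "y \<noteq> 0" using opnorm_set_nonempty by blast
  then have "0 \<le> M" using upper[of y] P_nonneg[of y] P_nonneg[of "T y"]
    by (meson divide_nonneg_nonneg order_trans)
  have range: "P (T (A z)) \<le> M * P (A z)" for z
  proof (cases "P (A z) = 0")
    case True
    then show ?thesis using l(2)[of "A z"] P_nonneg[of "T (A z)"] by simp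
  next
    case False
    then have "A z \<noteq> 0" 
      by (auto simp: A_seminorm_def A_inner_def cinner_self
          linear_0[OF bounded_clinear_linear[OF bounded_clinear_A]])
    then have "P (T (A z)) / P (A z) \<le> M" using closure_subset[of "range A"] by (intro upper) auto
    then show ?thesis using False P_nonneg[of "A z"] by (simp add: divide_le_eq)
  qed
  \<comment> \<open>The error \<open>M * e\<close> comes from replacing \<open>P (A z)\<close> by
    \<open>P x\<close>, the error \<open>l * e\<close> from the remainder
    \<open>T (x - A z)\<close>.\<close>
  have approx: "P (T x) \<le> M * P x + (M + l) * e" if "e > 0" for e
  proof -
    obtain z where z: "P (x - A z) < e" using range_dense[OF \<open>e > 0\<close>] by blast
    have "T x = T (A z) + T (x - A z)"
      by (simp add: linear_diff[OF bounded_clinear_linear[OF clinear[OF T]]])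
    then have "P (T x) \<le> P (T (A z)) + P (T (x - A z))"
      using P_triangle[of "T (A z)" "T (x - A z)"] by simp
    moreover have "P (A z) \<le> P x + e"
      using P_triangle[of x "- (x - A z)"] P_scaleR[of "-1" "x - A z"] z by simp
    then have "M * P (A z) \<le> M * (P x + e)" using \<open>0 \<le> M\<close> by (rule mult_left_mono)
    moreover have "l * P (x - A z) \<le> l * e" using z l(1) by simp
    ultimately show ?thesis
      using range[of z] l(2)[of "x - A z"] by (simp add: distrib_left distrib_right)
  qed
  have "P (T x) \<le> M * P x + e" if "e > 0" for e
    using approx[of "e / (M + l)"] that \<open>0 \<le> M\<close> l(1)
    by (simp add: add_nonneg_pos less_imp_neq[THEN not_sym])
  then have "P (T x) \<le> M * P x" by (rule field_le_epsilon)
  with \<open>0 \<le> M\<close> show "P (T x) \<le> A_opnorm A T * P x" "0 \<le> A_opnorm A T"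
    by (simp_all add: M_def)
qed

lemma A_bounded_operators_funpow:
  assumes T: "T \<in> A_bounded_operators A"
  shows "T ^^ n \<in> A_bounded_operators A"
proof -
  obtain l where l: "l > 0" "\<And>x. P (T x) \<le> l * P x"
    using T unfolding A_bounded_operators_def by blast
  have "P ((T ^^ n) x) \<le> l ^ n * P x" for x
  proof (induction n)
    case (Suc n)
    have "P ((T ^^ Suc n) x) \<le> l * P ((T ^^ n) x)" using l(2) by simp
    also have "\<dots> \<le> l * (l ^ n * P x)" using Suc l(1) by (intro mult_left_mono) auto
    finally show ?case by (simp add: mult.assoc)
  qed simp
  then show ?thesis
    using bounded_clinear_funpow[OF clinear[OF T]] l(1) zero_less_power[OF l(1)]
    unfolding A_bounded_operators_def by blast
qed

text \<open>The term \<open>n = 1\<close> of the infimum is the seminorm of \<open>T\<close> itself,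
  so equality says exactly that no other root lies below it.\<close>

lemma normaloid_iff:
  assumes T: "T \<in> A_bounded_operators A"
  shows "A_normaloid A T \<longleftrightarrow> (\<forall>n\<ge>1. A_opnorm A T ^ n \<le> A_opnorm A (T ^^ n))"
proof -
  define M where "M = A_opnorm A T"
  define R where "R = {root n (A_opnorm A (T ^^ n)) | n. n \<ge> 1}"
  have norm_nonneg: "0 \<le> A_opnorm A (T ^^ n)" for n
    by (rule opnorm_nonneg) (rule A_bounded_operators_funpow[OF T])
  have bdd: "bdd_below R"
    by (rule bdd_belowI[of _ 0]) (auto simp: R_def norm_nonneg)
  have R: "root n (A_opnorm A (T ^^ n)) \<in> R" if "n \<ge> 1" for n using that by (auto simp: R_def)
  have "M \<in> R" using R[of 1] by (simp add: M_def)
  then have le: "Inf R \<le> M" using bdd by (rule cInf_lower)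
  have "Inf R = M \<longleftrightarrow> (\<forall>n\<ge>1. M ^ n \<le> A_opnorm A (T ^^ n))"
  proof
    assume eq: "Inf R = M"
    show "\<forall>n\<ge>1. M ^ n \<le> A_opnorm A (T ^^ n)"
    proof (intro allI impI)
      fix n :: nat
      assume n: "n \<ge> 1"
      have "M \<le> root n (A_opnorm A (T ^^ n))" using cInf_lower[OF R[OF n] bdd] eq by simp
      then have "M ^ n \<le> root n (A_opnorm A (T ^^ n)) ^ n"
        using opnorm_nonneg[OF T] by (intro power_mono) (simp_all add: M_def)
      then show "M ^ n \<le> A_opnorm A (T ^^ n)" using n norm_nonneg[of n] by simp
    qed
  next
    assume *: "\<forall>n\<ge>1. M ^ n \<le> A_opnorm A (T ^^ n)"
    have "M \<le> Inf R"
    proof (rule cInf_greatest)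
      show "R \<noteq> {}" using \<open>M \<in> R\<close> by blast
      fix y assume "y \<in> R"
      then obtain n where n: "n \<ge> 1" "y = root n (A_opnorm A (T ^^ n))" by (auto simp: R_def)
      then have "root n (M ^ n) \<le> y" using * by simp
      then show "M \<le> y" using n opnorm_nonneg[OF T] by (simp add: M_def real_root_power_cancel)
    qed
    with le show "Inf R = M" by simp
  qed
  then show ?thesis
    using T by (simp add: A_normaloid_def A_spectral_radius_def R_def M_def)
qed

section \<open>The numerical radius and maximizing sequences\<close>

lemma unit_normalize: "P x \<noteq> 0 \<Longrightarrow> P ((1 / P x) *\<^sub>R x) = 1"
  using P_nonneg[of x] by (simp add: P_scaleR)

lemma Q_scaleR_operator:
  assumes "bounded_clinear T"
  shows "Q (T (r *\<^sub>R x)) (r *\<^sub>R x) = complex_of_real (r\<^sup>2) * Q (T x) x"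
  by (simp add: scaleR_scaleC bounded_clinear_scaleC[OF assms] Q_scaleC_left Q_scaleC_right
      power2_eq_square)

lemma cmod_Q_operator_le:
  assumes T: "T \<in> A_bounded_operators A" and "P x = 1"
  shows "cmod (Q (T x) x) \<le> P (T x)" "P (T x) \<le> A_opnorm A T"
  using cmod_Q_le[of "T x" x] opnorm_bound[OF T, of x] assms(2) by simp_all

lemma numerical_radius_upper:
  assumes T: "T \<in> A_bounded_operators A" and "P x = 1"
  shows "cmod (Q (T x) x) \<le> A_numerical_radius A T"
  unfolding A_numerical_radius_def
proof (rule cSup_upper)
  show "cmod (Q (T x) x) \<in> {cmod (Q (T x) x) | x. P x = 1}" using assms(2) by blast
  show "bdd_above {cmod (Q (T x) x) | x. P x = 1}"
    using order_trans[OF cmod_Q_operator_le[OF T]]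
    by (intro bdd_aboveI[of _ "A_opnorm A T"]) blast
qed

lemma numerical_radius_nonneg:
  assumes T: "T \<in> A_bounded_operators A"
  shows "0 \<le> A_numerical_radius A T"
proof -
  obtain x where "P x = 1" by (rule exists_unit)
  then show ?thesis using numerical_radius_upper[OF T, of x] norm_ge_zero order_trans by blast
qed

lemma numerical_radius_bound:
  assumes T: "T \<in> A_bounded_operators A"
  shows "cmod (Q (T x) x) \<le> A_numerical_radius A T * (P x)\<^sup>2"
proof (cases "P x = 0")
  case True
  then show ?thesis using cmod_Q_le[of "T x" x] by simp
next
  case False
  have "cmod (Q (T ((1 / P x) *\<^sub>R x)) ((1 / P x) *\<^sub>R x)) \<le> A_numerical_radius A T"
    using T unit_normalize[OF False] by (rule numerical_radius_upper)
  then show ?thesis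
    using False unfolding Q_scaleR_operator[OF clinear[OF T]]
    by (simp add: norm_mult norm_divide norm_power field_simps)
qed

lemma exists_numerical_radius_seq:
  obtains x where "\<And>n::nat. P (x n) = 1"
    "\<And>n. A_numerical_radius A T - 1 / real (Suc n) < cmod (Q (T (x n)) (x n))"
proof -
  have "\<exists>x. P x = 1 \<and> A_numerical_radius A T - 1 / real (Suc n) < cmod (Q (T x) x)" for n
  proof -
    obtain x where "P x = 1" by (rule exists_unit)
    then have "{cmod (Q (T x) x) | x. P x = 1} \<noteq> {}" by blast
    then have "\<exists>y\<in>{cmod (Q (T x) x) | x. P x = 1}. A_numerical_radius A T - 1 / real (Suc n) < y"
      unfolding A_numerical_radius_def by (intro less_cSupD) auto
    then show ?thesis by blast
  qed
  then show ?thesis using that by metis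
qed

text \<open>By \<open>opnorm_le\<close> a constant slightly below the seminorm of \<open>T\<close>
  fails on some vector of the whole space, which is then normalized.\<close>

lemma exists_opnorm_seq:
  assumes T: "T \<in> A_bounded_operators A"
  obtains x where "\<And>n::nat. P (x n) = 1" "(\<lambda>n. P (T (x n))) \<longlonglongrightarrow> A_opnorm A T"
proof -
  define M where "M = A_opnorm A T"
  have "\<exists>x. P x = 1 \<and> M - 1 / real (Suc n) \<le> P (T x)" for n
  \<comment> \<open>\<open>opnorm_le\<close> applies to nonnegative constants; for the others any
    unit vector will do.\<close>
  proof (cases "M - 1 / real (Suc n) \<le> 0")
    case True
    obtain x where "P x = 1" by (rule exists_unit)
    then show ?thesis using True P_nonneg[of "T x"] order_trans by blast
  next
    case False
    then have "\<not> A_opnorm A T \<le> M - 1 / real (Suc n)" by (simp add: M_def)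
    then obtain x where x: "\<not> P (T x) \<le> (M - 1 / real (Suc n)) * P x"
      using opnorm_le[of T "M - 1 / real (Suc n)"] False by force
    have "P x \<noteq> 0"
      using x opnorm_bound[OF T, of x] P_nonneg[of "T x"] by auto
    then have "0 < P x" using P_nonneg[of x] by linarith
    have "T ((1 / P x) *\<^sub>R x) = (1 / P x) *\<^sub>R T x"
      by (rule linear_scale[OF bounded_clinear_linear[OF clinear[OF T]]])
    then have "P (T ((1 / P x) *\<^sub>R x)) = P (T x) / P x"
      using \<open>0 < P x\<close> by (simp add: P_scaleR)
    moreover have "M - 1 / real (Suc n) \<le> P (T x) / P x"
      using x \<open>0 < P x\<close> by (simp add: le_divide_eq)
    ultimately show ?thesis using unit_normalize[OF \<open>P x \<noteq> 0\<close>] by metis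
  qed
  then obtain x where x: "\<And>n. P (x n) = 1" "\<And>n. M - 1 / real (Suc n) \<le> P (T (x n))" by metis
  have null: "(\<lambda>n. M - 1 / real (Suc n)) \<longlonglongrightarrow> M"
    using tendsto_diff[OF tendsto_const LIMSEQ_inverse_real_of_nat, of M]
    by (simp add: inverse_eq_divide)
  have "(\<lambda>n. P (T (x n))) \<longlonglongrightarrow> M"
    by (rule tendsto_sandwich[OF _ _ null tendsto_const])
      (use x cmod_Q_operator_le(2)[OF T] in \<open>simp_all add: M_def\<close>)
  then show ?thesis unfolding M_def by (rule that[OF x(1)])
qed

section \<open>The maximal numerical range\<close>

text \<open>The values of the form are bounded by the seminorm of \<open>T\<close>, so
  Bolzano--Weierstrass in the plane applies.\<close>

lemma max_numerical_range_subseq: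
  assumes T: "T \<in> A_bounded_operators A" and unit: "\<And>n. P (x n) = 1"
    and lim: "(\<lambda>n. P (T (x n))) \<longlonglongrightarrow> A_opnorm A T"
  obtains l \<rho> where "strict_mono (\<rho> :: nat \<Rightarrow> nat)" "l \<in> A_max_numerical_range A T"
    "(\<lambda>n. Q (T (x (\<rho> n))) (x (\<rho> n))) \<longlonglongrightarrow> l"
proof -
  define f where "f n = Q (T (x n)) (x n)" for n
  have "cmod (f n) \<le> A_opnorm A T" for n
    unfolding f_def using cmod_Q_operator_le[OF T unit] by (rule order_trans)
  then have "bounded (range f)" unfolding bounded_iff by blast
  then obtain l \<rho> where \<rho>: "strict_mono (\<rho> :: nat \<Rightarrow> nat)" "(f \<circ> \<rho>) \<longlonglongrightarrow> l"
    using bounded_imp_convergent_subsequence by blast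
  have "(\<lambda>n. P (T (x (\<rho> n)))) \<longlonglongrightarrow> A_opnorm A T"
    using LIMSEQ_subseq_LIMSEQ[OF lim \<rho>(1)] by (simp add: comp_def)
  moreover have f_lim: "(\<lambda>n. Q (T (x (\<rho> n))) (x (\<rho> n))) \<longlonglongrightarrow> l"
    using \<rho>(2) by (simp add: f_def comp_def)
  ultimately have "l \<in> A_max_numerical_range A T"
    unfolding A_max_numerical_range_def using unit by (intro CollectI exI[of _ "\<lambda>n. x (\<rho> n)"]) simp
  then show ?thesis using that \<rho>(1) f_lim by blast
qed

lemma max_numerical_range_nonempty:
  assumes T: "T \<in> A_bounded_operators A"
  shows "A_max_numerical_range A T \<noteq> {}"
proof -
  obtain x where "\<And>n::nat. P (x n) = 1" "(\<lambda>n. P (T (x n))) \<longlonglongrightarrow> A_opnorm A T"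
    by (rule exists_opnorm_seq[OF T]) blast
  then show ?thesis using max_numerical_range_subseq[OF T, of x] by blast
qed

lemma max_numerical_range_le:
  assumes T: "T \<in> A_bounded_operators A" and "l \<in> A_max_numerical_range A T"
  shows "cmod l \<le> A_numerical_radius A T"
proof -
  obtain x where x: "\<And>n::nat. P (x n) = 1" "(\<lambda>n. Q (T (x n)) (x n)) \<longlonglongrightarrow> l"
    using assms(2) unfolding A_max_numerical_range_def by blast
  show ?thesis
    using tendsto_norm[OF x(2)] numerical_radius_upper[OF T x(1)]
    by (intro LIMSEQ_le_const2) auto
qed

lemma max_numerical_radius_upper:
  assumes T: "T \<in> A_bounded_operators A" and "l \<in> A_max_numerical_range A T"
  shows "cmod l \<le> A_max_numerical_radius A T"
  unfolding A_max_numerical_radius_def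
proof (rule cSup_upper)
  show "bdd_above {cmod l | l. l \<in> A_max_numerical_range A T}"
    using max_numerical_range_le[OF T] by (intro bdd_aboveI[of _ "A_numerical_radius A T"]) blast
qed (use assms(2) in blast)

lemma max_numerical_radius_le:
  assumes T: "T \<in> A_bounded_operators A"
  shows "A_max_numerical_radius A T \<le> A_numerical_radius A T"
  unfolding A_max_numerical_radius_def
proof (rule cSup_least)
  show "{cmod l | l. l \<in> A_max_numerical_range A T} \<noteq> {}"
    using max_numerical_range_nonempty[OF T] by blast
qed (use max_numerical_range_le[OF T] in blast)

section \<open>The power inequality and normaloid operators\<close>

text \<open>Polarization bounds the sesquilinear form by its quadratic form, and the parallelogram
  law adds up the squares.\<close>

lemma opnorm_le_if_numerical_bound:
  assumes T: "T \<in> A_bounded_operators A" and "0 \<le> w"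
    and w: "\<And>x. cmod (Q (T x) x) \<le> w * (P x)\<^sup>2"
  shows "A_opnorm A T \<le> 2 * w"
proof (rule opnorm_le)
  note lin = bounded_clinear_linear[OF clinear[OF T]]
  have sum_le: "cmod (Q (T x) y + Q (T y) x) \<le> w * ((P x)\<^sup>2 + (P y)\<^sup>2)" for x y
  proof -
    have "Q (T (x + y)) (x + y) = Q (T (x - y)) (x - y) + 2 * (Q (T x) y + Q (T y) x)"
      by (simp add: linear_add[OF lin] linear_diff[OF lin] Q_add_left Q_add_right
          Q_diff_left Q_diff_right)
    then have "2 * cmod (Q (T x) y + Q (T y) x)
        = cmod (Q (T (x + y)) (x + y) - Q (T (x - y)) (x - y))"
      by (simp only: add_diff_cancel_left' norm_mult norm_numeral)
    also have "\<dots> \<le> w * (P (x + y))\<^sup>2 + w * (P (x - y))\<^sup>2"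
      using norm_triangle_ineq4 w[of "x + y"] w[of "x - y"] by (smt (verit))
    also have "\<dots> = 2 * (w * ((P x)\<^sup>2 + (P y)\<^sup>2))"
      unfolding P_power2 by (simp add: expand algebra_simps)
    finally show ?thesis by simp
  qed
  \<comment> \<open>Replacing \<open>y\<close> by \<open>\<i> *\<^sub>C y\<close> in
    \<open>sum_le\<close> bounds the difference of the two terms as well; sum and difference add to
    \<open>2 * Q (T x) y\<close>.\<close>
  have form_le: "cmod (Q (T x) y) \<le> w * ((P x)\<^sup>2 + (P y)\<^sup>2)" for x y
  proof -
    have "Q (T x) (\<i> *\<^sub>C y) + Q (T (\<i> *\<^sub>C y)) x = - \<i> * (Q (T x) y - Q (T y) x)"
      by (simp add: bounded_clinear_scaleC[OF clinear[OF T]] Q_scaleC_left Q_scaleC_right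
          algebra_simps)
    then have "cmod (Q (T x) y - Q (T y) x) \<le> w * ((P x)\<^sup>2 + (P y)\<^sup>2)"
      using sum_le[of x "\<i> *\<^sub>C y"] by (simp add: norm_mult P_scaleC)
    moreover have "2 * cmod (Q (T x) y)
        = cmod ((Q (T x) y + Q (T y) x) + (Q (T x) y - Q (T y) x))"
      by (simp add: norm_mult flip: mult_2)
    ultimately show ?thesis
      using sum_le[of x y]
        norm_triangle_ineq[of "Q (T x) y + Q (T y) x" "Q (T x) y - Q (T y) x"] by linarith
  qed
  show "P (T x) \<le> 2 * w * P x" for x
  proof (cases "P x = 0 \<or> P (T x) = 0")
    case True
    then show ?thesis using opnorm_bound[OF T, of x] P_nonneg[of x] \<open>0 \<le> w\<close> by auto
  next
    case False
    then have pos: "0 < P x" "0 < P (T x)" using P_nonneg[of x] P_nonneg[of "T x"] by auto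
    \<comment> \<open>Scales \<open>T x\<close> to the seminorm of \<open>x\<close>, which balances
      the two squares in \<open>form_le\<close>.\<close>
    define t where "t = P x / P (T x)"
    have "Q (T x) (t *\<^sub>R T x) = complex_of_real (t * (P (T x))\<^sup>2)"
      using Im_Q_self[of "T x"] P_power2[of "T x"]
      by (simp add: complex_eq_iff scaleR_scaleC Q_scaleC_right)
    then have "t * (P (T x))\<^sup>2 \<le> w * ((P x)\<^sup>2 + (P (t *\<^sub>R T x))\<^sup>2)"
      using form_le[of x "t *\<^sub>R T x"] pos by (simp add: t_def norm_mult norm_divide norm_power)
    moreover have "P (t *\<^sub>R T x) = P x" using pos by (simp add: P_scaleR t_def)
    moreover have "t * (P (T x))\<^sup>2 = P x * P (T x)" using pos by (simp add: t_def power2_eq_square)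
    ultimately have "P x * P (T x) \<le> w * ((P x)\<^sup>2 + (P x)\<^sup>2)" by simp
    also have "\<dots> = P x * (2 * w * P x)" by (simp add: power2_eq_square)
    finally have "P x * P (T x) \<le> P x * (2 * w * P x)" .
    then show ?thesis using pos(1) by simp
  qed
qed (use \<open>0 \<le> w\<close> in simp)

text \<open>
  For \<open>S = c T\<close> with \<open>\<bar>c\<bar> = 1\<close> put \<open>u = w x + S x\<close> and \<open>v = w x - S x\<close>. Then \<open>(w - S) u\<close> and
  \<open>(w + S) v\<close> both equal \<open>(w\<^sup>2 - S\<^sup>2) x\<close>, while \<open>u + v = 2 w x\<close>.
\<close>

lemma numerical_bound_square:
  assumes T: "bounded_clinear T" and "0 < w"
    and w: "\<And>x. cmod (Q (T x) x) \<le> w * (P x)\<^sup>2"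
  shows "cmod (Q (T (T x)) x) \<le> w\<^sup>2 * (P x)\<^sup>2"
proof -
  obtain d where d: "cmod d = 1" "d * Q (T (T x)) x = complex_of_real (cmod (Q (T (T x)) x))"
    by (rule exists_unimodular_mult)
  \<comment> \<open>A square root of the phase \<open>d\<close>, because \<open>S (S x)\<close>
    carries the factor \<open>c * c\<close>.\<close>
  define c where "c = csqrt d"
  have c: "c * c = d" "cmod c = 1"
    using d(1) power2_csqrt[of d] by (simp_all add: c_def power2_eq_square)
  define S where "S y = c *\<^sub>C T y" for y
  have lin: "linear S"
    unfolding S_def by (rule bounded_clinear_linear[OF bounded_clinear_scaleC_comp[OF T]])
  have S: "\<bar>b (S y) y\<bar> \<le> w * b y y" for y
    using w[of y] abs_Re_le_cmod[of "c * Q (T y) y"]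
    by (simp add: S_def Q_scaleC_left norm_mult c P_power2)
  define u v where "u = w *\<^sub>R x + S x" and "v = w *\<^sub>R x - S x"
  have "0 \<le> b (w *\<^sub>R u - S u) u"
    using S[of u] by (simp add: expand)
  moreover have "w *\<^sub>R u - S u = w\<^sup>2 *\<^sub>R x - S (S x)"
    by (simp add: u_def linear_add[OF lin] linear_scale[OF lin] power2_eq_square algebra_simps)
  moreover have "0 \<le> b (w *\<^sub>R v + S v) v"
    using S[of v] by (simp add: expand)
  moreover have "w *\<^sub>R v + S v = w\<^sup>2 *\<^sub>R x - S (S x)"
    by (simp add: v_def linear_diff[OF lin] linear_scale[OF lin] power2_eq_square algebra_simps)
  ultimately have "0 \<le> b (w\<^sup>2 *\<^sub>R x - S (S x)) (u + v)"
    by (simp only: add_right)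
  also have "u + v = (2 * w) *\<^sub>R x" by (simp add: u_def v_def scaleR_2[symmetric])
  finally have "0 \<le> b (w\<^sup>2 *\<^sub>R x - S (S x)) x"
    using \<open>0 < w\<close> by (simp add: scaleR_right zero_le_mult_iff)
  then have "b (S (S x)) x \<le> w\<^sup>2 * (P x)\<^sup>2" by (simp add: diff_left scaleR_left P_power2)
  moreover have "b (S (S x)) x = cmod (Q (T (T x)) x)"
    using d(2)
    by (simp add: S_def bounded_clinear_scaleC[OF T] scaleC_scaleC c Q_scaleC_left)
  ultimately show ?thesis by simp
qed

text \<open>Iterated squaring reaches the exponents that are powers of two;
  \<open>le_if_power_le_mult_power\<close> asks for no more.\<close>

lemma numerical_bound_funpow:
  assumes T: "bounded_clinear T" and "0 < w"
    and w: "\<And>x. cmod (Q (T x) x) \<le> w * (P x)\<^sup>2"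
  shows "cmod (Q ((T ^^ (2 ^ k)) x) x) \<le> w ^ (2 ^ k) * (P x)\<^sup>2"
proof (induction k arbitrary: x)
  case 0
  then show ?case using w by simp
next
  case (Suc k)
  have "cmod (Q ((T ^^ (2 ^ k)) ((T ^^ (2 ^ k)) x)) x) \<le> (w ^ (2 ^ k))\<^sup>2 * (P x)\<^sup>2"
    by (rule numerical_bound_square[OF bounded_clinear_funpow[OF T]])
      (use Suc \<open>0 < w\<close> in auto)
  then show ?case
    by (simp add: mult_2 funpow_add power_add power2_eq_square)
qed

text \<open>For \<open>m = 2 ^ k\<close> the \<open>m\<close>-th power of the seminorm of
  \<open>T\<close> is at most the seminorm of \<open>T ^^ m\<close>, hence at most
  \<open>2 * w ^ m\<close>; the factor 2 disappears as \<open>k\<close> grows.\<close>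

lemma opnorm_le_numerical_radius:
  assumes T: "T \<in> A_bounded_operators A" and "A_normaloid A T"
  shows "A_opnorm A T \<le> A_numerical_radius A T"
\<comment> \<open>A number \<open>w\<close> strictly above the numerical radius is positive, as
  \<open>numerical_bound_square\<close> requires.\<close>
proof (rule dense_ge)
  fix w assume less: "A_numerical_radius A T < w"
  then have "0 < w" using numerical_radius_nonneg[OF T] by linarith
  have w: "cmod (Q (T x) x) \<le> w * (P x)\<^sup>2" for x
    using numerical_radius_bound[OF T, of x] mult_right_mono[OF less_imp_le[OF less], of "(P x)\<^sup>2"]
    by simp
  show "A_opnorm A T \<le> w"
  proof (rule le_if_power_le_mult_power[where K = 2])
    fix k :: nat
    have "A_opnorm A T ^ (2 ^ k) \<le> A_opnorm A (T ^^ (2 ^ k))"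
      using assms(2) unfolding normaloid_iff[OF T] by simp
    also have "\<dots> \<le> 2 * w ^ (2 ^ k)"
      using numerical_bound_funpow[OF clinear[OF T] \<open>0 < w\<close> w] \<open>0 < w\<close>
      by (intro opnorm_le_if_numerical_bound A_bounded_operators_funpow[OF T]) auto
    finally show "\<exists>n\<ge>k. A_opnorm A T ^ n \<le> 2 * w ^ n"
      by (intro exI[of _ "2 ^ k"]) (simp add: less_imp_le)
  qed (use \<open>0 < w\<close> opnorm_nonneg[OF T] in auto)
qed

text \<open>\<open>cmod (Q (T x) x)\<close>, \<open>P (T x)\<close> and \<open>M\<close> increase in
  this order on unit vectors. As \<open>M\<close> is at most the numerical radius, a sequence
  approaching that radius forces the first two to tend to \<open>M\<close>, so its limit points lie
  in the maximal numerical range.\<close>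

lemma max_numerical_radius_if_normaloid:
  assumes T: "T \<in> A_bounded_operators A" and "A_normaloid A T"
  shows "A_numerical_radius A T = A_max_numerical_radius A T"
proof (rule antisym)
  define M where "M = A_opnorm A T"
  have M: "M \<le> A_numerical_radius A T"
    unfolding M_def using assms by (rule opnorm_le_numerical_radius)
  obtain x where x: "\<And>n::nat. P (x n) = 1"
    "\<And>n. A_numerical_radius A T - 1 / real (Suc n) < cmod (Q (T (x n)) (x n))"
    by (rule exists_numerical_radius_seq[of T]) blast
  have upper: "P (T (x n)) \<le> M" "cmod (Q (T (x n)) (x n)) \<le> P (T (x n))" for n
    using cmod_Q_operator_le[OF T x(1)[of n]] by (simp_all add: M_def)
  have lower: "M - 1 / real (Suc n) \<le> cmod (Q (T (x n)) (x n))" for n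
    using x(2)[of n] M by linarith
  have null: "(\<lambda>n. M - 1 / real (Suc n)) \<longlonglongrightarrow> M"
    using tendsto_diff[OF tendsto_const LIMSEQ_inverse_real_of_nat, of M]
    by (simp add: inverse_eq_divide)
  have lim_Q: "(\<lambda>n. cmod (Q (T (x n)) (x n))) \<longlonglongrightarrow> M"
    by (rule tendsto_sandwich[OF _ _ null tendsto_const])
      (use lower order_trans[OF upper(2,1)] in auto)
  have lim_P: "(\<lambda>n. P (T (x n))) \<longlonglongrightarrow> A_opnorm A T"
    unfolding M_def[symmetric]
    by (rule tendsto_sandwich[OF _ _ lim_Q tendsto_const]) (use upper in auto)
  obtain l \<rho> where l: "strict_mono (\<rho> :: nat \<Rightarrow> nat)" "l \<in> A_max_numerical_range A T"
    "(\<lambda>n. Q (T (x (\<rho> n))) (x (\<rho> n))) \<longlonglongrightarrow> l"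
    using max_numerical_range_subseq[OF T x(1) lim_P] .
  have "cmod l = M"
    using tendsto_norm[OF l(3)] LIMSEQ_subseq_LIMSEQ[OF lim_Q l(1)] LIMSEQ_unique
    by (fastforce simp: comp_def)
  moreover have "A_numerical_radius A T \<le> M"
  proof (rule LIMSEQ_le_const)
    show "(\<lambda>n. M + 1 / real (Suc n)) \<longlonglongrightarrow> M"
      using tendsto_add[OF tendsto_const LIMSEQ_inverse_real_of_nat, of M]
      by (simp add: inverse_eq_divide)
    have "A_numerical_radius A T \<le> M + 1 / real (Suc n)" for n
      using x(2)[of n] upper[of n] by linarith
    then show "\<exists>N. \<forall>n\<ge>N. A_numerical_radius A T \<le> M + 1 / real (Suc n)" by blast
  qed
  ultimately show "A_numerical_radius A T \<le> A_max_numerical_radius A T"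
    using max_numerical_radius_upper[OF T l(2)] by simp
qed (rule max_numerical_radius_le[OF T])

section \<open>From equal radii to normaloid operators\<close>

text \<open>A diagonal choice: for each tolerance take a point of the maximal numerical range whose
  modulus is nearly the supremum, then a late member of the sequence that defines this
  point.\<close>

lemma exists_extremal_seq:
  assumes T: "T \<in> A_bounded_operators A"
    and eq: "A_numerical_radius A T = A_max_numerical_radius A T"
  obtains x l where "\<And>n::nat. P (x n) = 1" "(\<lambda>n. P (T (x n))) \<longlonglongrightarrow> A_opnorm A T"
    "(\<lambda>n. Q (T (x n)) (x n)) \<longlonglongrightarrow> l" "cmod l = A_numerical_radius A T"
proof -
  define M w where "M = A_opnorm A T" and "w = A_numerical_radius A T"
  have "\<exists>x. P x = 1 \<and> \<bar>P (T x) - M\<bar> \<le> e \<and> w - e \<le> cmod (Q (T x) x)" if "0 < e" for e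
  proof -
    have "\<exists>y\<in>{cmod l | l. l \<in> A_max_numerical_range A T}. w - e < y"
      unfolding w_def eq A_max_numerical_radius_def
      using max_numerical_range_nonempty[OF T] \<open>0 < e\<close> by (intro less_cSupD) auto
    then obtain l where l: "l \<in> A_max_numerical_range A T" "w - e < cmod l" by blast
    then obtain y where y: "\<And>n::nat. P (y n) = 1" "(\<lambda>n. Q (T (y n)) (y n)) \<longlonglongrightarrow> l"
      "(\<lambda>n. P (T (y n))) \<longlonglongrightarrow> M"
      unfolding A_max_numerical_range_def M_def by blast
    have "eventually (\<lambda>n. w - e < cmod (Q (T (y n)) (y n))) sequentially"
      using order_tendstoD(1)[OF tendsto_norm[OF y(2)] l(2)] .
    moreover have "eventually (\<lambda>n. dist (P (T (y n))) M < e) sequentially"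
      using tendstoD[OF y(3) \<open>0 < e\<close>] .
    ultimately have "eventually (\<lambda>n. w - e < cmod (Q (T (y n)) (y n)) \<and> dist (P (T (y n))) M < e)
        sequentially"
      by (rule eventually_conj)
    then obtain n where "w - e < cmod (Q (T (y n)) (y n))" "dist (P (T (y n))) M < e"
      unfolding eventually_sequentially by blast
    then show ?thesis using y(1)[of n] by (intro exI[of _ "y n"]) (auto simp: dist_real_def)
  qed
  then have "\<exists>x. P x = 1 \<and> \<bar>P (T x) - M\<bar> \<le> inverse (real (Suc n))
      \<and> w - inverse (real (Suc n)) \<le> cmod (Q (T x) x)" for n
    by simp
  then obtain x where x: "\<And>n. P (x n) = 1" "\<And>n. \<bar>P (T (x n)) - M\<bar> \<le> inverse (real (Suc n))"
    "\<And>n. w - inverse (real (Suc n)) \<le> cmod (Q (T (x n)) (x n))"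
    by metis
  have "(\<lambda>n. P (T (x n)) - M) \<longlonglongrightarrow> 0"
    by (rule Lim_null_comparison[OF _ LIMSEQ_inverse_real_of_nat]) (use x(2) in auto)
  then have lim_P: "(\<lambda>n. P (T (x n))) \<longlonglongrightarrow> A_opnorm A T"
    by (simp add: LIM_zero_iff M_def)
  have null: "(\<lambda>n. w - inverse (real (Suc n))) \<longlonglongrightarrow> w"
    using tendsto_diff[OF tendsto_const LIMSEQ_inverse_real_of_nat, of w] by simp
  have lim_Q: "(\<lambda>n. cmod (Q (T (x n)) (x n))) \<longlonglongrightarrow> w"
    by (rule tendsto_sandwich[OF _ _ null tendsto_const])
      (use x(3) numerical_radius_upper[OF T x(1)] in \<open>auto simp: w_def\<close>)
  \<comment> \<open>So far only the moduli of the form converge; along the subsequence the values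
    themselves do.\<close>
  obtain l \<rho> where l: "strict_mono (\<rho> :: nat \<Rightarrow> nat)" "l \<in> A_max_numerical_range A T"
    "(\<lambda>n. Q (T (x (\<rho> n))) (x (\<rho> n))) \<longlonglongrightarrow> l"
    using max_numerical_range_subseq[OF T x(1) lim_P] .
  have "(\<lambda>n. cmod (Q (T (x (\<rho> n))) (x (\<rho> n)))) \<longlonglongrightarrow> w"
    using LIMSEQ_subseq_LIMSEQ[OF lim_Q l(1)] by (simp add: comp_def)
  then have "cmod l = w" using tendsto_norm[OF l(3)] LIMSEQ_unique by blast
  moreover have "(\<lambda>n. P (T (x (\<rho> n)))) \<longlonglongrightarrow> A_opnorm A T"
    using LIMSEQ_subseq_LIMSEQ[OF lim_P l(1)] by (simp add: comp_def)
  ultimately show ?thesis using that[of "\<lambda>n. x (\<rho> n)" l] x(1) l(3) by (simp add: w_def)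
qed

text \<open>Rotating by the phase of the limit \<open>l\<close> makes the limit equal to
  \<open>w\<close> and leaves the seminorms of all powers unchanged. The sequence is then extremal
  for \<open>S\<close>, and \<open>power_le_if_extremal\<close> yields the criterion
  \<open>normaloid_iff\<close>.\<close>

lemma normaloid_if_max_numerical_radius:
  assumes T: "T \<in> A_bounded_operators A"
    and eq: "A_numerical_radius A T = A_max_numerical_radius A T"
  shows "A_normaloid A T"
  unfolding normaloid_iff[OF T]
proof (intro allI impI)
  fix n :: nat
  define w where "w = A_numerical_radius A T"
  obtain x l where x: "\<And>n::nat. P (x n) = 1" "(\<lambda>n. P (T (x n))) \<longlonglongrightarrow> A_opnorm A T"
    "(\<lambda>n. Q (T (x n)) (x n)) \<longlonglongrightarrow> l" "cmod l = w"
    unfolding w_def by (rule exists_extremal_seq[OF T eq]) blast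
  obtain c where c: "cmod c = 1" "c * l = complex_of_real (cmod l)"
    by (rule exists_unimodular_mult)
  define S where "S y = c *\<^sub>C T y" for y
  have S_pow: "(S ^^ n) y = (c ^ n) *\<^sub>C (T ^^ n) y" for y
    using funpow_scaleC[OF clinear[OF T]] unfolding S_def .
  have b_S: "b (S y) (S y) = (P (T y))\<^sup>2" for y
    unfolding P_power2[symmetric] by (simp add: S_def P_scaleC c)
  show "A_opnorm A T ^ n \<le> A_opnorm A (T ^^ n)"
  proof (rule power_le_if_extremal[where S = S and x = x and w = w])
    show "linear S"
      unfolding S_def
      by (rule bounded_clinear_linear[OF bounded_clinear_scaleC_comp[OF clinear[OF T]]])
    show "b (S y) (S y) \<le> (A_opnorm A T)\<^sup>2 * b y y" for y
      using power_mono[OF opnorm_bound[OF T, of y] P_nonneg, of 2]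
      by (simp add: b_S power_mult_distrib P_power2)
    show "b (S y) y \<le> w * b y y" for y
      using numerical_radius_bound[OF T, of y] complex_Re_le_cmod[of "c * Q (T y) y"]
      by (simp add: S_def Q_scaleC_left norm_mult c P_power2 w_def)
    show "b (x i) (x i) = 1" for i using x(1)[of i] by (simp flip: P_power2)
    have "(\<lambda>i. Re (c * Q (T (x i)) (x i))) \<longlonglongrightarrow> Re (c * l)"
      by (intro tendsto_intros x)
    then show "(\<lambda>i. b (S (x i)) (x i)) \<longlonglongrightarrow> w"
      by (simp only: S_def Q_scaleC_left c x Re_complex_of_real)
    show "(\<lambda>i. b (S (x i)) (S (x i))) \<longlonglongrightarrow> (A_opnorm A T)\<^sup>2"
      unfolding b_S by (intro tendsto_intros x)
    show "b ((S ^^ n) y) ((S ^^ n) y) \<le> (A_opnorm A (T ^^ n))\<^sup>2 * b y y" for y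
      using power_mono[OF opnorm_bound[OF A_bounded_operators_funpow[OF T, of n], of y] P_nonneg, of 2]
      unfolding P_power2[symmetric]
      by (simp add: S_pow P_scaleC norm_power c power_mult_distrib)
  qed (use opnorm_nonneg T A_bounded_operators_funpow in auto)
qed

end

theorem proposition2p5:
  fixes A T :: "'a::chilbert_space \<Rightarrow> 'a"
  assumes nontrivial: "(UNIV :: 'a set) \<noteq> {0}"
    and positive: "positive_operator A"
    and nonzero: "A \<noteq> (\<lambda>x. 0)"
    and A_bounded: "T \<in> A_bounded_operators A"
  shows "A_normaloid A T \<longleftrightarrow> A_numerical_radius A T = A_max_numerical_radius A T"
proof -
  interpret semi_Hilbertian A
    using positive nonzero by unfold_locales
  show ?thesis
    using max_numerical_radius_if_normaloid[OF A_bounded]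
      normaloid_if_max_numerical_radius[OF A_bounded] by blast
qed

end
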